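(* Let $X=(X,\varepsilon(X))$ be an exterior space. (i) If $X$ is locally path-connected, then $\check{\pi}_0(X)=\check c(X)$ and $e_0L(X)=eL(X)$. (ii) If $X$ is locally path-connected and regular at infinity, then $\check{\pi}_0(X)=\check{\bar\pi}_0(X)=\check c(X)=\check{\bar c}(X)$ and $e_0L(X)=\bar e_0\bar L(X)=eL(X)=\bar e\bar L(X)$. Here equalities of end spaces mean that the canonical natural maps between them are homeomorphisms, under which the indicated subsets correspond.
   Context: An externology on a topological space $X$ is a non-empty collection $\varepsilon(X)$ of open subsets closed under finite intersections and such that any open set containing a member of $\varepsilon(X)$ is in $\varepsilon(X)$. An exterior space is a topological space with an externology. It is regular at infinity if for every $E\in\varepsilon(X)$ there is $E'\in\varepsilon(X)$ with $\overline{E'}\subset E$. For a space $Y$, $\pi_0(Y)$ (resp. $c(Y)$) is the set of path-components (resp. connected components) with the quotient topology from $Y$. Regarding $\varepsilon(X)$ and $\{\overline{E}: E\in\varepsilon(X)\}$ as inverse systems under inclusions, define $L(X)=\bigcap_{E\in\varepsilon(X)}E$, $\bar L(X)=\bigcap_{E\in\varepsilon(X)}\overline{E}$ (subspaces of $X$), and the inverse limits in topological spaces $\check{\pi}_0(X)=\lim_{E}\pi_0(E)$, $\check c(X)=\lim_{E}c(E)$, $\check{\bar\pi}_0(X)=\lim_{E}\pi_0(\overline{E})$, $\check{\bar c}(X)=\lim_{E}c(\overline{E})$, $E\in\varepsilon(X)$. The inclusions $E\subset\overline{E}$ and the natural maps $\pi_0(Y)\to c(Y)$ induce the canonical maps $\check{\pi}_0(X)\to\check{\bar\pi}_0(X)$,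 $\check c(X)\to\check{\bar c}(X)$, $\check{\pi}_0(X)\to\check c(X)$, $\check{\bar\pi}_0(X)\to\check{\bar c}(X)$. The maps $e_0:L(X)\to\check{\pi}_0(X)$, $e:L(X)\to\check c(X)$, $\bar e_0:\bar L(X)\to\check{\bar\pi}_0(X)$, $\bar e:\bar L(X)\to\check{\bar c}(X)$ send $p$ to the family of (path-)components of $E$ (resp. $\overline{E}$) containing $p$, and $e_0L(X)$, $eL(X)$, $\bar e_0\bar L(X)$, $\bar e\bar L(X)$ denote their images. *)

theory Defs
  imports "HOL-Analysis.Analysis"
begin

section \<open>Exterior spaces\<close>

text \<open>Closure under the empty intersection, i.e. membership of the whole space, follows from
  nonemptiness and upward closure.\<close>

definition externology :: "'a topology \<Rightarrow> 'a set set \<Rightarrow> bool" where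
  "externology X \<epsilon> \<longleftrightarrow>
     \<epsilon> \<noteq> {} \<and>
     (\<forall>E\<in>\<epsilon>. openin X E) \<and>
     (\<forall>E\<in>\<epsilon>. \<forall>E'\<in>\<epsilon>. E \<inter> E' \<in> \<epsilon>) \<and>
     (\<forall>E\<in>\<epsilon>. \<forall>U. openin X U \<and> E \<subseteq> U \<longrightarrow> U \<in> \<epsilon>)"

definition regular_at_infinity :: "'a topology \<Rightarrow> 'a set set \<Rightarrow> bool" where
  "regular_at_infinity X \<epsilon> \<longleftrightarrow> (\<forall>E\<in>\<epsilon>. \<exists>E'\<in>\<epsilon>. X closure_of E' \<subseteq> E)"


section \<open>Spaces of components\<close>

definition quotient_topology :: "'a topology \<Rightarrow> ('a \<Rightarrow> 'b) \<Rightarrow> 'b topology" where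
  "quotient_topology Y q =
     topology (\<lambda>U. U \<subseteq> q ` topspace Y \<and> openin Y {y \<in> topspace Y. q y \<in> U})"

lemma openin_quotient_topology:
  "openin (quotient_topology Y q) U \<longleftrightarrow>
     U \<subseteq> q ` topspace Y \<and> openin Y {y \<in> topspace Y. q y \<in> U}"
proof -
  have "istopology (\<lambda>U. U \<subseteq> q ` topspace Y \<and> openin Y {y \<in> topspace Y. q y \<in> U})"
    unfolding istopology_def
  proof (intro conjI allI impI)
    fix S T assume S: "S \<subseteq> q ` topspace Y \<and> openin Y {y \<in> topspace Y. q y \<in> S}"
      and T: "T \<subseteq> q ` topspace Y \<and> openin Y {y \<in> topspace Y. q y \<in> T}"
    then show "S \<inter> T \<subseteq> q ` topspace Y" by blast
    have "{y \<in> topspace Y. q y \<in> S \<inter> T} =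
        {y \<in> topspace Y. q y \<in> S} \<inter> {y \<in> topspace Y. q y \<in> T}" by blast
    then show "openin Y {y \<in> topspace Y. q y \<in> S \<inter> T}"
      using S T openin_Int by (metis (no_types, lifting))
  next
    fix \<K> assume K: "\<forall>K\<in>\<K>. K \<subseteq> q ` topspace Y \<and> openin Y {y \<in> topspace Y. q y \<in> K}"
    then show "\<Union>\<K> \<subseteq> q ` topspace Y" by blast
    have "{y \<in> topspace Y. q y \<in> \<Union>\<K>} = (\<Union>K\<in>\<K>. {y \<in> topspace Y. q y \<in> K})" by blast
    then show "openin Y {y \<in> topspace Y. q y \<in> \<Union>\<K>}"
      using K openin_Union by (simp only:) blast
  qed
  then show ?thesis by (simp add: quotient_topology_def topology_inverse')
qed

lemma topspace_quotient_topology [simp]: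
  "topspace (quotient_topology Y q) = q ` topspace Y"
proof
  show "topspace (quotient_topology Y q) \<subseteq> q ` topspace Y"
    using openin_topspace[of "quotient_topology Y q"]
    unfolding openin_quotient_topology by (rule conjunct1)
  have "{y \<in> topspace Y. q y \<in> q ` topspace Y} = topspace Y" by blast
  then have "openin (quotient_topology Y q) (q ` topspace Y)"
    by (simp add: openin_quotient_topology)
  then show "q ` topspace Y \<subseteq> topspace (quotient_topology Y q)"
    by (rule openin_subset)
qed

lemma quotient_map_quotient_topology: "quotient_map Y (quotient_topology Y q) q"
  unfolding quotient_map_def openin_quotient_topology by simp

definition path_component_space :: "'a topology \<Rightarrow> 'a set topology" where
  "path_component_space Y = quotient_topology Y (path_component_of_set Y)"

definition connected_component_space :: "'a topology \<Rightarrow> 'a set topology" where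
  "connected_component_space Y = quotient_topology Y (connected_component_of_set Y)"

lemma topspace_path_component_space [simp]:
  "topspace (path_component_space Y) = path_components_of Y"
  by (simp add: path_component_space_def path_components_of_def)

lemma topspace_connected_component_space [simp]:
  "topspace (connected_component_space Y) = connected_components_of Y"
  by (simp add: connected_component_space_def connected_components_of_def)

text \<open>The maps \<open>\<pi>\<^sub>0(A) \<rightarrow> \<pi>\<^sub>0(B)\<close> and \<open>c(A) \<rightarrow> c(B)\<close> induced by an inclusion
  \<open>A \<subseteq> B\<close>, and the natural map \<open>\<pi>\<^sub>0(Y) \<rightarrow> c(Y)\<close>, all send the component of a point
  to the component of that point, that is, to the unique component in the target (a point
  of the space \<open>Z\<close> of components below) that contains the given set.\<close>

definition enclosing :: "'a set topology \<Rightarrow> 'a set \<Rightarrow> 'a set" where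
  "enclosing Z C = (THE D. D \<in> topspace Z \<and> C \<subseteq> D)"

lemma enclosing_path_component:
  assumes "A \<subseteq> B" and p: "p \<in> topspace (subtopology X A)"
  shows "enclosing (path_component_space (subtopology X B))
           (path_component_of_set (subtopology X A) p) = path_component_of_set (subtopology X B) p"
  unfolding enclosing_def
proof (rule the_equality)
  have pB: "p \<in> topspace (subtopology X B)" using assms by auto
  have pA: "p \<in> path_component_of_set (subtopology X A) p"
    using p by (simp add: path_component_of_refl)
  have sub: "path_component_of_set (subtopology X A) p \<subseteq> A"
    using path_component_of_subset_topspace[of "subtopology X A" p] by auto
  have "path_connectedin (subtopology X A) (path_component_of_set (subtopology X A) p)"
    by (rule path_connectedin_path_component_of)
  then have "path_connectedin (subtopology X B) (path_component_of_set (subtopology X A) p)"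
    using sub assms(1) by (simp add: path_connectedin_subtopology)
  then have "path_component_of_set (subtopology X A) p \<subseteq> path_component_of_set (subtopology X B) p"
    using pA by (rule path_component_of_maximal)
  then show "path_component_of_set (subtopology X B) p
      \<in> topspace (path_component_space (subtopology X B)) \<and>
    path_component_of_set (subtopology X A) p \<subseteq> path_component_of_set (subtopology X B) p"
    using pB unfolding topspace_path_component_space path_components_of_def by blast
  fix D assume D: "D \<in> topspace (path_component_space (subtopology X B)) \<and>
    path_component_of_set (subtopology X A) p \<subseteq> D"
  then obtain y where y: "D = path_component_of_set (subtopology X B) y"
    unfolding topspace_path_component_space path_components_of_def by blast
  have "p \<in> D" using D pA by blast
  then have "path_component_of (subtopology X B) y p" unfolding y by simp
  then have "path_component_of (subtopology X B) y = path_component_of (subtopology X B) p"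
    using path_component_of_equiv[of "subtopology X B" y p] by blast
  then show "D = path_component_of_set (subtopology X B) p" unfolding y by (rule arg_cong)
qed

lemma enclosing_connected_component:
  assumes "A \<subseteq> B" and p: "p \<in> topspace (subtopology X A)"
  shows "enclosing (connected_component_space (subtopology X B))
           (connected_component_of_set (subtopology X A) p)
         = connected_component_of_set (subtopology X B) p"
  unfolding enclosing_def
proof (rule the_equality)
  have pB: "p \<in> topspace (subtopology X B)" using assms by auto
  have pA: "p \<in> connected_component_of_set (subtopology X A) p"
    using p by (simp add: connected_component_of_refl)
  have sub: "connected_component_of_set (subtopology X A) p \<subseteq> A"
    using connected_component_of_subset_topspace[of "subtopology X A" p] by auto
  have "connectedin (subtopology X A) (connected_component_of_set (subtopology X A) p)"
    by (rule connectedin_connected_component_of)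
  then have "connectedin (subtopology X B) (connected_component_of_set (subtopology X A) p)"
    using sub assms(1) by (simp add: connectedin_subtopology)
  then have "connected_component_of_set (subtopology X A) p \<subseteq> connected_component_of_set (subtopology X B) p"
    using pA by (rule connected_component_of_maximal)
  then show "connected_component_of_set (subtopology X B) p
      \<in> topspace (connected_component_space (subtopology X B)) \<and>
    connected_component_of_set (subtopology X A) p \<subseteq> connected_component_of_set (subtopology X B) p"
    using pB unfolding topspace_connected_component_space connected_components_of_def by blast
  fix D assume D: "D \<in> topspace (connected_component_space (subtopology X B)) \<and>
    connected_component_of_set (subtopology X A) p \<subseteq> D"
  then obtain y where y: "D = connected_component_of_set (subtopology X B) y"
    unfolding topspace_connected_component_space connected_components_of_def by blast
  have "p \<in> D" using D pA by blast
  then have "connected_component_of (subtopology X B) y p" unfolding y by simp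
  then have "connected_component_of (subtopology X B) y = connected_component_of (subtopology X B) p"
    using connected_component_of_equiv[of "subtopology X B" y p] by blast
  then show "D = connected_component_of_set (subtopology X B) p" unfolding y by (rule arg_cong)
qed

lemma enclosing_path_component_connected_component:
  assumes p: "p \<in> topspace Y"
  shows "enclosing (connected_component_space Y) (path_component_of_set Y p)
         = connected_component_of_set Y p"
  unfolding enclosing_def
proof (rule the_equality)
  have pA: "p \<in> path_component_of_set Y p"
    using p by (simp add: path_component_of_refl)
  show "connected_component_of_set Y p \<in> topspace (connected_component_space Y) \<and>
    path_component_of_set Y p \<subseteq> connected_component_of_set Y p"
    using p path_component_subset_connected_component_of[of Y p]
    unfolding topspace_connected_component_space connected_components_of_def by blast
  fix D assume D: "D \<in> topspace (connected_component_space Y) \<and> path_component_of_set Y p \<subseteq> D"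
  then obtain y where y: "D = connected_component_of_set Y y"
    unfolding topspace_connected_component_space connected_components_of_def by blast
  have "p \<in> D" using D pA by blast
  then have "connected_component_of Y y p" unfolding y by simp
  then have "connected_component_of Y y = connected_component_of Y p"
    using connected_component_of_equiv[of "Y" y p] by blast
  then show "D = connected_component_of_set Y p" unfolding y by (rule arg_cong)
qed


section \<open>End spaces\<close>

text \<open>The inverse limit of the spaces of components \<open>T i\<close> of the sets \<open>S i\<close>, where the system
  is ordered by inclusion of the sets \<open>S i\<close>; it consists of the compatible families, with the
  subspace topology of the product.  In the limits over closures the index is still a member
  \<open>E\<close> of the externology, with \<open>S E\<close> the closure of \<open>E\<close>.  Indices with equal closures have
  equal coordinates, so the limit is that of the system of closures under inclusions.\<close>

definition component_limit ::
  "'i set \<Rightarrow> ('i \<Rightarrow> 'a set) \<Rightarrow> ('i \<Rightarrow> 'a set topology) \<Rightarrow> ('i \<Rightarrow> 'a set) topology" where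
  "component_limit I S T =
     subtopology (product_topology T I)
       {x. \<forall>i\<in>I. \<forall>j\<in>I. S i \<subseteq> S j \<longrightarrow> enclosing (T j) (x i) = x j}"

definition path_ends :: "'a topology \<Rightarrow> 'a set set \<Rightarrow> ('a set \<Rightarrow> 'a set) topology" where
  "path_ends X \<epsilon> =
     component_limit \<epsilon> (\<lambda>E. E) (\<lambda>E. path_component_space (subtopology X E))"

definition conn_ends :: "'a topology \<Rightarrow> 'a set set \<Rightarrow> ('a set \<Rightarrow> 'a set) topology" where
  "conn_ends X \<epsilon> =
     component_limit \<epsilon> (\<lambda>E. E) (\<lambda>E. connected_component_space (subtopology X E))"

definition closure_path_ends :: "'a topology \<Rightarrow> 'a set set \<Rightarrow> ('a set \<Rightarrow> 'a set) topology" where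
  "closure_path_ends X \<epsilon> =
     component_limit \<epsilon> (\<lambda>E. X closure_of E)
       (\<lambda>E. path_component_space (subtopology X (X closure_of E)))"

definition closure_conn_ends :: "'a topology \<Rightarrow> 'a set set \<Rightarrow> ('a set \<Rightarrow> 'a set) topology" where
  "closure_conn_ends X \<epsilon> =
     component_limit \<epsilon> (\<lambda>E. X closure_of E)
       (\<lambda>E. connected_component_space (subtopology X (X closure_of E)))"


section \<open>Canonical maps between end spaces\<close>

definition path_ends_to_conn_ends ::
  "'a topology \<Rightarrow> 'a set set \<Rightarrow> ('a set \<Rightarrow> 'a set) \<Rightarrow> ('a set \<Rightarrow> 'a set)" where
  "path_ends_to_conn_ends X \<epsilon> x =
     (\<lambda>E\<in>\<epsilon>. enclosing (connected_component_space (subtopology X E)) (x E))"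

definition path_ends_to_closure_path_ends ::
  "'a topology \<Rightarrow> 'a set set \<Rightarrow> ('a set \<Rightarrow> 'a set) \<Rightarrow> ('a set \<Rightarrow> 'a set)" where
  "path_ends_to_closure_path_ends X \<epsilon> x =
     (\<lambda>E\<in>\<epsilon>. enclosing (path_component_space (subtopology X (X closure_of E))) (x E))"

definition conn_ends_to_closure_conn_ends ::
  "'a topology \<Rightarrow> 'a set set \<Rightarrow> ('a set \<Rightarrow> 'a set) \<Rightarrow> ('a set \<Rightarrow> 'a set)" where
  "conn_ends_to_closure_conn_ends X \<epsilon> x =
     (\<lambda>E\<in>\<epsilon>. enclosing (connected_component_space (subtopology X (X closure_of E))) (x E))"

definition closure_path_ends_to_closure_conn_ends ::
  "'a topology \<Rightarrow> 'a set set \<Rightarrow> ('a set \<Rightarrow> 'a set) \<Rightarrow> ('a set \<Rightarrow> 'a set)" where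
  "closure_path_ends_to_closure_conn_ends X \<epsilon> x =
     (\<lambda>E\<in>\<epsilon>. enclosing (connected_component_space (subtopology X (X closure_of E))) (x E))"


section \<open>Limit sets and the ends they represent\<close>

definition limit_set :: "'a set set \<Rightarrow> 'a set" where
  "limit_set \<epsilon> = (\<Inter>E\<in>\<epsilon>. E)"

definition closure_limit_set :: "'a topology \<Rightarrow> 'a set set \<Rightarrow> 'a set" where
  "closure_limit_set X \<epsilon> = (\<Inter>E\<in>\<epsilon>. X closure_of E)"

definition path_end_of :: "'a topology \<Rightarrow> 'a set set \<Rightarrow> 'a \<Rightarrow> ('a set \<Rightarrow> 'a set)" where
  "path_end_of X \<epsilon> p = (\<lambda>E\<in>\<epsilon>. path_component_of_set (subtopology X E) p)"

definition conn_end_of :: "'a topology \<Rightarrow> 'a set set \<Rightarrow> 'a \<Rightarrow> ('a set \<Rightarrow> 'a set)" where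
  "conn_end_of X \<epsilon> p = (\<lambda>E\<in>\<epsilon>. connected_component_of_set (subtopology X E) p)"

definition closure_path_end_of :: "'a topology \<Rightarrow> 'a set set \<Rightarrow> 'a \<Rightarrow> ('a set \<Rightarrow> 'a set)" where
  "closure_path_end_of X \<epsilon> p =
     (\<lambda>E\<in>\<epsilon>. path_component_of_set (subtopology X (X closure_of E)) p)"

definition closure_conn_end_of :: "'a topology \<Rightarrow> 'a set set \<Rightarrow> 'a \<Rightarrow> ('a set \<Rightarrow> 'a set)" where
  "closure_conn_end_of X \<epsilon> p =
     (\<lambda>E\<in>\<epsilon>. connected_component_of_set (subtopology X (X closure_of E)) p)"

end

(* Path components and components of an open subset of a locally path-connected space
   coincide, so the path ends and the connected ends are the same limit.  Regularity at infinity
   says that the system of closures is cofinally interleaved with the system of the sets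
   themselves: choosing E' with closure contained in E, the coordinate at E' of a family of
   components of closures determines a component of E.  This gives the inverse of each map
   from a limit over the sets E to the limit over their closures.  The fourth canonical map is
   a homeomorphism because the square of canonical maps commutes. *)

theory Submission
  imports Defs
begin

lemma externology_openin: "\<lbrakk>externology X \<epsilon>; E \<in> \<epsilon>\<rbrakk> \<Longrightarrow> openin X E"
  unfolding externology_def by blast

lemma externology_Int: "\<lbrakk>externology X \<epsilon>; E \<in> \<epsilon>; E' \<in> \<epsilon>\<rbrakk> \<Longrightarrow> E \<inter> E' \<in> \<epsilon>"
  unfolding externology_def by blast

lemma externology_subset_closure: "\<lbrakk>externology X \<epsilon>; E \<in> \<epsilon>\<rbrakk> \<Longrightarrow> E \<subseteq> X closure_of E"
  using closure_of_subset[OF openin_subset[OF externology_openin]] .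

section \<open>Limits of component systems\<close>

text \<open>Both kinds of components at once: \<open>K A p\<close> is the component of \<open>p\<close> in the subspace \<open>A\<close>,
  and \<open>T A\<close> the space of these components.\<close>

locale component_system =
  fixes X :: "'a topology" and K :: "'a set \<Rightarrow> 'a \<Rightarrow> 'a set" and T :: "'a set \<Rightarrow> 'a set topology"
  assumes T_eq: "T A = quotient_topology (subtopology X A) (K A)"
    and enclosing_component:
      "\<lbrakk>A \<subseteq> B; p \<in> topspace (subtopology X A)\<rbrakk> \<Longrightarrow> enclosing (T B) (K A p) = K B p"
begin

lemma topspace_T: "topspace (T A) = K A ` (topspace X \<inter> A)"
  by (simp add: T_eq)

lemma enclosing_K: "\<lbrakk>A \<subseteq> B; p \<in> topspace X; p \<in> A\<rbrakk> \<Longrightarrow> enclosing (T B) (K A p) = K B p"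
  using enclosing_component by simp

text \<open>The induced maps are functorial: \<open>D\<close> is the component of some point
  \<open>p\<close>, and both sides are the component of \<open>p\<close> in
  \<open>C\<close>.\<close>

lemma enclosing_enclosing:
  assumes "A \<subseteq> B" "B \<subseteq> C" "D \<in> topspace (T A)"
  shows "enclosing (T C) (enclosing (T B) D) = enclosing (T C) D"
proof -
  obtain p where p: "p \<in> topspace X" "p \<in> A" "D = K A p"
    using assms(3) by (auto simp: topspace_T)
  then have "p \<in> B" using assms(1) by blast
  moreover have "A \<subseteq> C" using assms by blast
  ultimately show ?thesis using p assms by (simp add: enclosing_K)
qed

text \<open>Precomposing with the quotient map \<open>K A\<close> gives \<open>K B\<close>
  restricted to \<open>A\<close>, which is continuous, so the universal property of the quotient
  applies.\<close>

lemma continuous_map_enclosing: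
  assumes "A \<subseteq> B"
  shows "continuous_map (T A) (T B) (enclosing (T B))"
proof -
  have "quotient_map (subtopology X A) (T A) (K A)"
    unfolding T_eq by (rule quotient_map_quotient_topology)
  moreover have "continuous_map (subtopology X A) (T B) (K B)"
    using quotient_imp_continuous_map[OF quotient_map_quotient_topology[of "subtopology X B" "K B"]]
      assms unfolding T_eq[symmetric] by (rule continuous_map_from_subtopology_mono)
  then have "continuous_map (subtopology X A) (T B) (enclosing (T B) \<circ> K A)"
    by (rule continuous_map_eq) (use assms in \<open>simp add: enclosing_K\<close>)
  ultimately show ?thesis
    by (rule continuous_compose_quotient_map)
qed

text \<open>The systems compared below share one index set and differ only in the sets
  \<open>S i\<close>; this lets the limits over members and over closures both be indexed by
  \<open>\<epsilon>\<close>.\<close>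

abbreviation lim :: "'i set \<Rightarrow> ('i \<Rightarrow> 'a set) \<Rightarrow> ('i \<Rightarrow> 'a set) topology" where
  "lim I S \<equiv> component_limit I S (\<lambda>i. T (S i))"

lemma topspace_lim_iff:
  "x \<in> topspace (lim I S) \<longleftrightarrow>
     x \<in> (\<Pi>\<^sub>E i\<in>I. topspace (T (S i))) \<and>
     (\<forall>i\<in>I. \<forall>j\<in>I. S i \<subseteq> S j \<longrightarrow> enclosing (T (S j)) (x i) = x j)"
  by (simp add: component_limit_def)

text \<open>Each coordinate is a projection followed by an induced map, hence continuous. Both
  directions of the interleaving are instances: one with the identity as \<open>\<phi>\<close>, one
  with a genuine choice of smaller sets.\<close>

lemma continuous_map_refinement:
  assumes dir: "\<And>i j. \<lbrakk>i \<in> I; j \<in> I\<rbrakk> \<Longrightarrow> \<exists>k\<in>I. S k \<subseteq> S i \<and> S k \<subseteq> S j"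
    and \<phi>: "\<And>i. i \<in> I \<Longrightarrow> \<phi> i \<in> I" "\<And>i. i \<in> I \<Longrightarrow> S (\<phi> i) \<subseteq> S' i"
  shows "continuous_map (lim I S) (lim I S') (\<lambda>x. \<lambda>i\<in>I. enclosing (T (S' i)) (x (\<phi> i)))"
    (is "continuous_map _ _ ?f")
  unfolding component_limit_def[of I S']
proof (rule continuous_map_into_subtopology)
  have proj: "continuous_map (lim I S) (T (S (\<phi> i))) (\<lambda>x. x (\<phi> i))" if "i \<in> I" for i
    unfolding component_limit_def
    using continuous_map_product_projection[OF \<phi>(1)[OF that], of "\<lambda>i. T (S i)"]
    by (rule continuous_map_from_subtopology)
  have "continuous_map (lim I S) (T (S' i)) (enclosing (T (S' i)) \<circ> (\<lambda>x. x (\<phi> i)))"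
    if "i \<in> I" for i
    by (rule continuous_map_compose[OF proj[OF that] continuous_map_enclosing[OF \<phi>(2)[OF that]]])
  then show "continuous_map (lim I S) (product_topology (\<lambda>i. T (S' i)) I) ?f"
    by (auto simp: continuous_map_componentwise o_def)
  show "?f \<in> topspace (lim I S) \<rightarrow>
      {x. \<forall>i\<in>I. \<forall>j\<in>I. S' i \<subseteq> S' j \<longrightarrow> enclosing (T (S' j)) (x i) = x j}"
  proof (clarsimp)
    fix x i j assume x: "x \<in> topspace (lim I S)" and ij: "i \<in> I" "j \<in> I" "S' i \<subseteq> S' j"
    \<comment> \<open>Nothing relates \<open>S (\<phi> i)\<close> to \<open>S (\<phi> j)\<close>
      even when \<open>S' i\<close> lies in \<open>S' j\<close>, so both coordinates are obtained
      from a common smaller index.\<close>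
    obtain k where k: "k \<in> I" "S k \<subseteq> S (\<phi> i)" "S k \<subseteq> S (\<phi> j)"
      using dir[OF \<phi>(1) \<phi>(1)] ij by blast
    have xk: "x k \<in> topspace (T (S k))" "x (\<phi> i) = enclosing (T (S (\<phi> i))) (x k)"
      "x (\<phi> j) = enclosing (T (S (\<phi> j))) (x k)"
      using x k ij \<phi>(1) unfolding topspace_lim_iff by (simp_all add: PiE_iff)
    have "S k \<subseteq> S' i" using k(2) \<phi>(2)[OF ij(1)] by (rule subset_trans)
    then show "enclosing (T (S' j)) (enclosing (T (S' i)) (x (\<phi> i))) = enclosing (T (S' j)) (x (\<phi> j))"
      unfolding xk(2,3)
      using enclosing_enclosing[OF _ _ xk(1)] k(2,3) ij(3) \<phi>(2)[OF ij(1)] \<phi>(2)[OF ij(2)] by presburger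
  qed
qed

text \<open>The inverse reads the coordinate at an index \<open>\<phi> i\<close> with
  \<open>S' (\<phi> i)\<close> inside \<open>S i\<close>. In either composite, functoriality leaves
  a single induced map from the coordinate at \<open>\<phi> i\<close>, and compatibility of the
  family identifies the result with the coordinate at \<open>i\<close>.\<close>

lemma homeomorphic_map_interleaved:
  assumes dir: "\<And>i j. \<lbrakk>i \<in> I; j \<in> I\<rbrakk> \<Longrightarrow> \<exists>k\<in>I. S k \<subseteq> S i \<and> S k \<subseteq> S j"
    and dir': "\<And>i j. \<lbrakk>i \<in> I; j \<in> I\<rbrakk> \<Longrightarrow> \<exists>k\<in>I. S' k \<subseteq> S' i \<and> S' k \<subseteq> S' j"
    and sub: "\<And>i. i \<in> I \<Longrightarrow> S i \<subseteq> S' i"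
    and \<phi>: "\<And>i. i \<in> I \<Longrightarrow> \<exists>j\<in>I. S' j \<subseteq> S i"
  shows "homeomorphic_map (lim I S) (lim I S') (\<lambda>x. \<lambda>i\<in>I. enclosing (T (S' i)) (x i))"
    (is "homeomorphic_map _ _ ?f")
proof -
  obtain \<phi> where \<phi>: "\<And>i. i \<in> I \<Longrightarrow> \<phi> i \<in> I" "\<And>i. i \<in> I \<Longrightarrow> S' (\<phi> i) \<subseteq> S i"
    using \<phi> by metis
  let ?g = "\<lambda>y. \<lambda>i\<in>I. enclosing (T (S i)) (y (\<phi> i))"
  have "continuous_map (lim I S) (lim I S') ?f"
    using dir sub by (intro continuous_map_refinement[of I S "\<lambda>i. i" S']) auto
  moreover have "continuous_map (lim I S') (lim I S) ?g"
    using dir' \<phi> by (rule continuous_map_refinement)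
  moreover have "?g (?f x) = x" if x: "x \<in> topspace (lim I S)" for x
  proof (rule ext)
    fix i
    show "?g (?f x) i = x i"
    proof (cases "i \<in> I")
      case True
      have s: "S (\<phi> i) \<subseteq> S i" using True \<phi> sub by blast
      have "?g (?f x) i = enclosing (T (S i)) (enclosing (T (S' (\<phi> i))) (x (\<phi> i)))"
        using True \<phi> by simp
      also have "\<dots> = enclosing (T (S i)) (x (\<phi> i))"
        using True \<phi> sub x by (intro enclosing_enclosing[of "S (\<phi> i)"]) (auto simp: topspace_lim_iff)
      also have "\<dots> = x i"
        using x True \<phi>(1) s by (simp add: topspace_lim_iff)
      finally show ?thesis .
    \<comment> \<open>Outside \<open>I\<close> both sides are \<open>undefined\<close>, because
      points of the product are extensional.\<close>
    qed (use x in \<open>auto simp: topspace_lim_iff\<close>)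
  qed
  moreover have "?f (?g y) = y" if y: "y \<in> topspace (lim I S')" for y
  proof (rule ext)
    fix i
    show "?f (?g y) i = y i"
    proof (cases "i \<in> I")
      case True
      have s: "S' (\<phi> i) \<subseteq> S' i" using True \<phi> sub by blast
      have "?f (?g y) i = enclosing (T (S' i)) (enclosing (T (S i)) (y (\<phi> i)))"
        using True by simp
      also have "\<dots> = enclosing (T (S' i)) (y (\<phi> i))"
        using True \<phi> sub y by (intro enclosing_enclosing[of "S' (\<phi> i)"]) (auto simp: topspace_lim_iff)
      also have "\<dots> = y i"
        using y True \<phi>(1) s by (simp add: topspace_lim_iff)
      finally show ?thesis .
    qed (use y in \<open>auto simp: topspace_lim_iff\<close>)
  qed
  ultimately have "homeomorphic_maps (lim I S) (lim I S') ?f ?g"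
    by (simp add: homeomorphic_maps_def)
  then show ?thesis
    using homeomorphic_map_maps by blast
qed

text \<open>Closure under intersections makes both systems directed, and regularity at infinity
  supplies the smaller closures required for the inverse.\<close>

lemma homeomorphic_map_closure:
  assumes "externology X \<epsilon>" "regular_at_infinity X \<epsilon>"
  shows "homeomorphic_map (lim \<epsilon> (\<lambda>E. E)) (lim \<epsilon> (\<lambda>E. X closure_of E))
           (\<lambda>x. \<lambda>E\<in>\<epsilon>. enclosing (T (X closure_of E)) (x E))"
proof (rule homeomorphic_map_interleaved[of \<epsilon> "\<lambda>E. E" "\<lambda>E. X closure_of E"])
  fix E E' assume E: "E \<in> \<epsilon>" "E' \<in> \<epsilon>"
  then have Int: "E \<inter> E' \<in> \<epsilon>"
    using externology_Int[OF assms(1)] by blast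
  then show "\<exists>F\<in>\<epsilon>. F \<subseteq> E \<and> F \<subseteq> E'" by blast
  show "\<exists>F\<in>\<epsilon>. X closure_of F \<subseteq> X closure_of E \<and> X closure_of F \<subseteq> X closure_of E'"
    by (intro bexI[OF _ Int] conjI closure_of_mono Int_lower1 Int_lower2)
next
  fix E assume E: "E \<in> \<epsilon>"
  then show "E \<subseteq> X closure_of E"
    using externology_subset_closure[OF assms(1)] by simp
  show "\<exists>F\<in>\<epsilon>. X closure_of F \<subseteq> E"
    using E assms(2) by (simp add: regular_at_infinity_def)
qed

end

interpretation path: component_system X "\<lambda>A. path_component_of_set (subtopology X A)"
  "\<lambda>A. path_component_space (subtopology X A)" for X :: "'a topology"
  \<comment> \<open>Keeping \<open>topspace_subtopology\<close> out of the simplifier leaves the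
    membership premise in the form that \<open>enclosing_path_component\<close> expects.\<close>
  by unfold_locales (simp_all add: path_component_space_def[symmetric] enclosing_path_component del: topspace_subtopology)

interpretation conn: component_system X "\<lambda>A. connected_component_of_set (subtopology X A)"
  "\<lambda>A. connected_component_space (subtopology X A)" for X :: "'a topology"
  by unfold_locales (simp_all add: connected_component_space_def[symmetric] enclosing_connected_component del: topspace_subtopology)

section \<open>The canonical maps\<close>

lemma path_component_space_eq:
  assumes "locally_path_connected_space Y"
  shows "path_component_space Y = connected_component_space Y"
  using assms
  by (simp add: path_component_space_def connected_component_space_def
      path_component_eq_connected_component_of)

text \<open>Members of the externology are open and so inherit local path-connectedness. Both limits
  then have the same factors, and the canonical map is the identity on them.\<close>

lemma homeomorphic_map_path_conn:
  assumes "locally_path_connected_space X" "externology X \<epsilon>"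
  shows "homeomorphic_map (path_ends X \<epsilon>) (conn_ends X \<epsilon>) (path_ends_to_conn_ends X \<epsilon>)"
proof -
  have T: "path_component_space (subtopology X E) = connected_component_space (subtopology X E)"
    if "E \<in> \<epsilon>" for E
    using path_component_space_eq[OF locally_path_connected_space_open_subset[OF assms(1)]]
      externology_openin[OF assms(2) that] .
  \<comment> \<open>The two families of spaces are known to agree only on \<open>\<epsilon>\<close>,
    so the limits are compared by the identity map instead of being rewritten. Arbitrary families
    allow use in both directions.\<close>
  have continuous_id: "continuous_map (component_limit \<epsilon> S T) (component_limit \<epsilon> S T') (\<lambda>x. x)"
    if "\<And>E. E \<in> \<epsilon> \<Longrightarrow> T E = T' E" for S :: "'a set \<Rightarrow> 'a set" and T T'
    unfolding component_limit_def[of _ _ T']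
  proof (rule continuous_map_into_subtopology)
    have "continuous_map (component_limit \<epsilon> S T) (T' E) (\<lambda>x. x E)" if "E \<in> \<epsilon>" for E
      unfolding component_limit_def \<open>\<And>E. E \<in> \<epsilon> \<Longrightarrow> T E = T' E\<close>[OF that, symmetric]
      by (rule continuous_map_from_subtopology) (rule continuous_map_product_projection[OF that])
    then show "continuous_map (component_limit \<epsilon> S T) (product_topology T' \<epsilon>) (\<lambda>x. x)"
      by (auto simp: continuous_map_componentwise component_limit_def PiE_iff)
    show "(\<lambda>x. x) \<in> topspace (component_limit \<epsilon> S T) \<rightarrow>
        {x. \<forall>i\<in>\<epsilon>. \<forall>j\<in>\<epsilon>. S i \<subseteq> S j \<longrightarrow> enclosing (T' j) (x i) = x j}"
      using that by (auto simp: component_limit_def)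
  qed
  have "homeomorphic_map (path_ends X \<epsilon>) (conn_ends X \<epsilon>) (\<lambda>x. x)"
    unfolding homeomorphic_map_maps homeomorphic_maps_def path_ends_def conn_ends_def
    using T by (auto intro!: exI[of _ "\<lambda>x. x"] continuous_id)
  moreover have "path_ends_to_conn_ends X \<epsilon> x = x" if "x \<in> topspace (path_ends X \<epsilon>)" for x
  proof (rule ext)
    fix E
    show "path_ends_to_conn_ends X \<epsilon> x E = x E"
    proof (cases "E \<in> \<epsilon>")
      case True
      \<comment> \<open>This is compatibility of the family for the trivial inclusion of
        \<open>E\<close> in itself.\<close>
      then have "enclosing (path_component_space (subtopology X E)) (x E) = x E"
        using that by (simp add: path_ends_def path.topspace_lim_iff)
      then show ?thesis
        using True by (simp add: T path_ends_to_conn_ends_def)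
    qed (use that in \<open>auto simp: path_ends_def path.topspace_lim_iff path_ends_to_conn_ends_def\<close>)
  qed
  ultimately show ?thesis
    by (auto intro: homeomorphic_map_eq)
qed

lemma homeomorphic_map_path_closure_path:
  assumes "externology X \<epsilon>" "regular_at_infinity X \<epsilon>"
  shows "homeomorphic_map (path_ends X \<epsilon>) (closure_path_ends X \<epsilon>) (path_ends_to_closure_path_ends X \<epsilon>)"
  using path.homeomorphic_map_closure[OF assms]
  unfolding path_ends_def closure_path_ends_def path_ends_to_closure_path_ends_def .

lemma homeomorphic_map_conn_closure_conn:
  assumes "externology X \<epsilon>" "regular_at_infinity X \<epsilon>"
  shows "homeomorphic_map (conn_ends X \<epsilon>) (closure_conn_ends X \<epsilon>) (conn_ends_to_closure_conn_ends X \<epsilon>)"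
  using conn.homeomorphic_map_closure[OF assms]
  unfolding conn_ends_def closure_conn_ends_def conn_ends_to_closure_conn_ends_def .

text \<open>If \<open>x E\<close> is the path component of \<open>p\<close> in \<open>E\<close>,
  both routes lead to the connected component of \<open>p\<close> in the closure of
  \<open>E\<close>.\<close>

lemma canonical_square:
  assumes "externology X \<epsilon>" and x: "x \<in> topspace (path_ends X \<epsilon>)"
  shows "closure_path_ends_to_closure_conn_ends X \<epsilon> (path_ends_to_closure_path_ends X \<epsilon> x) =
         conn_ends_to_closure_conn_ends X \<epsilon> (path_ends_to_conn_ends X \<epsilon> x)"
proof -
  have "enclosing (connected_component_space (subtopology X (X closure_of E)))
          (enclosing (path_component_space (subtopology X (X closure_of E))) (x E)) =
        enclosing (connected_component_space (subtopology X (X closure_of E)))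
          (enclosing (connected_component_space (subtopology X E)) (x E))" if "E \<in> \<epsilon>" for E
  proof -
    have "x E \<in> topspace (path_component_space (subtopology X E))"
      using x that by (auto simp: path_ends_def path.topspace_lim_iff)
    then obtain p where p: "p \<in> topspace X" "p \<in> E" "x E = path_component_of_set (subtopology X E) p"
      unfolding path.topspace_T by blast
    have "E \<subseteq> X closure_of E"
      using externology_subset_closure[OF assms(1) that] .
    then show ?thesis
      using p by (auto simp: path.enclosing_K conn.enclosing_K enclosing_path_component_connected_component)
  qed
  then show ?thesis
    by (auto simp: closure_path_ends_to_closure_conn_ends_def path_ends_to_closure_path_ends_def
        conn_ends_to_closure_conn_ends_def path_ends_to_conn_ends_def intro!: restrict_ext)
qed

text \<open>Closures of members need not be locally path-connected, so components cannot be compared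
  set by set. The map is instead the composite around the other three sides of the square.\<close>

lemma homeomorphic_map_closure_path_closure_conn:
  assumes "locally_path_connected_space X" "externology X \<epsilon>" "regular_at_infinity X \<epsilon>"
  shows "homeomorphic_map (closure_path_ends X \<epsilon>) (closure_conn_ends X \<epsilon>)
           (closure_path_ends_to_closure_conn_ends X \<epsilon>)"
proof -
  obtain g where g: "homeomorphic_maps (path_ends X \<epsilon>) (closure_path_ends X \<epsilon>)
      (path_ends_to_closure_path_ends X \<epsilon>) g"
    using homeomorphic_map_path_closure_path[OF assms(2,3)] homeomorphic_map_maps by blast
  then have hg: "homeomorphic_map (closure_path_ends X \<epsilon>) (path_ends X \<epsilon>) g"
    using homeomorphic_map_maps homeomorphic_maps_sym by blast
  have "homeomorphic_map (closure_path_ends X \<epsilon>) (closure_conn_ends X \<epsilon>)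
      (conn_ends_to_closure_conn_ends X \<epsilon> \<circ> (path_ends_to_conn_ends X \<epsilon> \<circ> g))"
    using homeomorphic_map_compose[OF homeomorphic_map_compose[OF hg
          homeomorphic_map_path_conn[OF assms(1,2)]] homeomorphic_map_conn_closure_conn[OF assms(2,3)]] .
  moreover have "(conn_ends_to_closure_conn_ends X \<epsilon> \<circ> (path_ends_to_conn_ends X \<epsilon> \<circ> g)) y =
      closure_path_ends_to_closure_conn_ends X \<epsilon> y" if "y \<in> topspace (closure_path_ends X \<epsilon>)" for y
  proof -
    \<comment> \<open>Since \<open>y\<close> is the image of \<open>g y\<close>, the square
      evaluated at \<open>g y\<close> gives the claim.\<close>
    have "g y \<in> topspace (path_ends X \<epsilon>)" "path_ends_to_closure_path_ends X \<epsilon> (g y) = y"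
      using g that by (auto simp: homeomorphic_maps_def continuous_map_def)
    then show ?thesis
      using canonical_square[OF assms(2)] by fastforce
  qed
  ultimately show ?thesis
    by (rule homeomorphic_map_eq)
qed

section \<open>Ends represented by limit points\<close>

context
  fixes X :: "'a topology" and \<epsilon> :: "'a set set"
  assumes ext: "externology X \<epsilon>"
begin

lemma subset_topspace: "E \<in> \<epsilon> \<Longrightarrow> E \<subseteq> topspace X"
  using openin_subset[OF externology_openin[OF ext]] .

lemma in_limit_setD: "\<lbrakk>p \<in> limit_set \<epsilon>; E \<in> \<epsilon>\<rbrakk> \<Longrightarrow> p \<in> topspace X \<and> p \<in> E"
  using subset_topspace by (auto simp: limit_set_def)

lemma in_closure_limit_setD:
  "\<lbrakk>p \<in> closure_limit_set X \<epsilon>; E \<in> \<epsilon>\<rbrakk> \<Longrightarrow> p \<in> topspace X \<and> p \<in> X closure_of E"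
  using closure_of_subset_topspace[of X E] by (auto simp: closure_limit_set_def)

text \<open>A limit point \<open>p\<close> lies in every \<open>E\<close>, so each coordinate is a
  component of \<open>p\<close> and is sent to the larger component of the same point. The next
  three lemmas follow the same pattern.\<close>

lemma path_ends_to_conn_ends_path_end_of:
  "p \<in> limit_set \<epsilon> \<Longrightarrow> path_ends_to_conn_ends X \<epsilon> (path_end_of X \<epsilon> p) = conn_end_of X \<epsilon> p"
  using in_limit_setD
  by (auto simp: path_ends_to_conn_ends_def path_end_of_def conn_end_of_def
      enclosing_path_component_connected_component intro!: restrict_ext)

lemma path_ends_to_closure_path_ends_path_end_of:
  "p \<in> limit_set \<epsilon> \<Longrightarrow>
    path_ends_to_closure_path_ends X \<epsilon> (path_end_of X \<epsilon> p) = closure_path_end_of X \<epsilon> p"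
  using in_limit_setD externology_subset_closure[OF ext]
  by (auto simp: path_ends_to_closure_path_ends_def path_end_of_def closure_path_end_of_def
      path.enclosing_K intro!: restrict_ext)

lemma conn_ends_to_closure_conn_ends_conn_end_of:
  "p \<in> limit_set \<epsilon> \<Longrightarrow>
    conn_ends_to_closure_conn_ends X \<epsilon> (conn_end_of X \<epsilon> p) = closure_conn_end_of X \<epsilon> p"
  using in_limit_setD externology_subset_closure[OF ext]
  by (auto simp: conn_ends_to_closure_conn_ends_def conn_end_of_def closure_conn_end_of_def
      conn.enclosing_K intro!: restrict_ext)

lemma closure_path_ends_to_closure_conn_ends_closure_path_end_of:
  "p \<in> closure_limit_set X \<epsilon> \<Longrightarrow>
    closure_path_ends_to_closure_conn_ends X \<epsilon> (closure_path_end_of X \<epsilon> p) = closure_conn_end_of X \<epsilon> p"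
  using in_closure_limit_setD
  by (auto simp: closure_path_ends_to_closure_conn_ends_def closure_path_end_of_def
      closure_conn_end_of_def enclosing_path_component_connected_component intro!: restrict_ext)

text \<open>Every \<open>E\<close> contains the closure of some member, so a point in all closures
  lies in all members. Hence the ends over closures are represented by the same points.\<close>

lemma closure_limit_set_eq: "regular_at_infinity X \<epsilon> \<Longrightarrow> closure_limit_set X \<epsilon> = limit_set \<epsilon>"
  using externology_subset_closure[OF ext]
  unfolding closure_limit_set_def limit_set_def regular_at_infinity_def by blast

end

theorem proposition3p15:
  fixes X :: "'a topology" and \<epsilon> :: "'a set set"
  assumes "externology X \<epsilon>"
  shows
    "(locally_path_connected_space X \<longrightarrow>
        homeomorphic_map (path_ends X \<epsilon>) (conn_ends X \<epsilon>) (path_ends_to_conn_ends X \<epsilon>) \<and>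
        path_ends_to_conn_ends X \<epsilon> ` (path_end_of X \<epsilon> ` limit_set \<epsilon>)
          = conn_end_of X \<epsilon> ` limit_set \<epsilon>)
     \<and>
     (locally_path_connected_space X \<and> regular_at_infinity X \<epsilon> \<longrightarrow>
        homeomorphic_map (path_ends X \<epsilon>) (closure_path_ends X \<epsilon>)
          (path_ends_to_closure_path_ends X \<epsilon>) \<and>
        homeomorphic_map (path_ends X \<epsilon>) (conn_ends X \<epsilon>) (path_ends_to_conn_ends X \<epsilon>) \<and>
        homeomorphic_map (conn_ends X \<epsilon>) (closure_conn_ends X \<epsilon>)
          (conn_ends_to_closure_conn_ends X \<epsilon>) \<and>
        homeomorphic_map (closure_path_ends X \<epsilon>) (closure_conn_ends X \<epsilon>)
          (closure_path_ends_to_closure_conn_ends X \<epsilon>) \<and>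
        path_ends_to_closure_path_ends X \<epsilon> ` (path_end_of X \<epsilon> ` limit_set \<epsilon>)
          = closure_path_end_of X \<epsilon> ` closure_limit_set X \<epsilon> \<and>
        path_ends_to_conn_ends X \<epsilon> ` (path_end_of X \<epsilon> ` limit_set \<epsilon>)
          = conn_end_of X \<epsilon> ` limit_set \<epsilon> \<and>
        conn_ends_to_closure_conn_ends X \<epsilon> ` (conn_end_of X \<epsilon> ` limit_set \<epsilon>)
          = closure_conn_end_of X \<epsilon> ` closure_limit_set X \<epsilon> \<and>
        closure_path_ends_to_closure_conn_ends X \<epsilon> `
            (closure_path_end_of X \<epsilon> ` closure_limit_set X \<epsilon>)
          = closure_conn_end_of X \<epsilon> ` closure_limit_set X \<epsilon>)"
proof -
  have maps:
    "path_ends_to_conn_ends X \<epsilon> ` (path_end_of X \<epsilon> ` limit_set \<epsilon>) = conn_end_of X \<epsilon> ` limit_set \<epsilon>"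
    "path_ends_to_closure_path_ends X \<epsilon> ` (path_end_of X \<epsilon> ` limit_set \<epsilon>)
       = closure_path_end_of X \<epsilon> ` limit_set \<epsilon>"
    "conn_ends_to_closure_conn_ends X \<epsilon> ` (conn_end_of X \<epsilon> ` limit_set \<epsilon>)
       = closure_conn_end_of X \<epsilon> ` limit_set \<epsilon>"
    using path_ends_to_conn_ends_path_end_of[OF assms]
      path_ends_to_closure_path_ends_path_end_of[OF assms]
      conn_ends_to_closure_conn_ends_conn_end_of[OF assms]
    by (simp_all add: image_image)
  \<comment> \<open>The pointwise lemma concerns \<open>closure_limit_set X \<epsilon>\<close>;
    regularity is what transfers it to \<open>limit_set \<epsilon>\<close>.\<close>
  have closure_map: "closure_path_ends_to_closure_conn_ends X \<epsilon> ` (closure_path_end_of X \<epsilon> ` limit_set \<epsilon>)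
       = closure_conn_end_of X \<epsilon> ` limit_set \<epsilon>"
    if "regular_at_infinity X \<epsilon>"
    using closure_path_ends_to_closure_conn_ends_closure_path_end_of[OF assms]
    by (simp_all add: image_image flip: closure_limit_set_eq[OF assms that])
  show ?thesis
    using maps closure_map closure_limit_set_eq[OF assms] homeomorphic_map_path_conn[OF _ assms]
      homeomorphic_map_path_closure_path[OF assms] homeomorphic_map_conn_closure_conn[OF assms]
      homeomorphic_map_closure_path_closure_conn[OF _ assms]
    by simp
qed

end
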